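(* There exists a Borel measurable function $f:\mathbb{R}\to[0,\infty)$ that is vertically rigid via horizontal translations, such that $f$ is not of the form $x\mapsto a+bx$ with $a,b\in\mathbb{R}$, and $f$ is not of the form $x\mapsto a+be^{g(x)}$ with $a,b\in\mathbb{R}$ and $g:\mathbb{R}\to\mathbb{R}$ an additive function.
   Context: For a function $h:\mathbb{R}\to\mathbb{R}$, $\mathrm{graph}(h)=\{(x,h(x)):x\in\mathbb{R}\}\subset\mathbb{R}^2$. A function $f:\mathbb{R}\to\mathbb{R}$ is vertically rigid via horizontal translations if for every $c\in(0,\infty)$ there exists a horizontal translation $\varphi$ of $\mathbb{R}^2$ (a map $(x,y)\mapsto(x+t,y)$ with $t\in\mathbb{R}$) such that $\varphi(\mathrm{graph}(cf))=\mathrm{graph}(f)$. A function $g:\mathbb{R}\to\mathbb{R}$ is additive if $g(x+y)=g(x)+g(y)$ for all $x,y\in\mathbb{R}$. *)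

theory Defs
  imports "HOL-Analysis.Analysis"
begin

definition graph_of :: "(real \<Rightarrow> real) \<Rightarrow> (real \<times> real) set" where
  "graph_of h = {(x, h x) | x. True}"

definition horizontal_translation :: "(real \<times> real \<Rightarrow> real \<times> real) \<Rightarrow> bool" where
  "horizontal_translation \<phi> \<longleftrightarrow> (\<exists>t. \<phi> = (\<lambda>(x, y). (x + t, y)))"

definition vertically_rigid_horizontal :: "(real \<Rightarrow> real) \<Rightarrow> bool" where
  "vertically_rigid_horizontal f \<longleftrightarrow>
     (\<forall>c>0. \<exists>\<phi>. horizontal_translation \<phi> \<and>
        \<phi> ` graph_of (\<lambda>x. c * f x) = graph_of f)"

end

theory Submission
  imports Defs "HOL-Real_Asymp.Real_Asymp"
begin

text \<open>
  Write \<open>\<langle>u\<rangle>\<close> for the signed distance of \<open>u\<close> from its nearest integer. The points \<open>x\<close> at which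
  \<open>\<surd>m \<langle>m! x\<rangle>\<close> converges form a proper Borel subgroup \<open>H\<close> of the reals, on which the limit
  \<open>L\<close> is a Borel measurable homomorphism onto the reals: the values of \<open>\<langle>m! x\<rangle>\<close> can be
  prescribed up to \<open>O(1/m)\<close> by a series \<open>\<Sum>a\<^sub>k / k!\<close> with integer \<open>a\<^sub>k\<close>.
  The function \<open>exp \<circ> L\<close> on \<open>H\<close>, extended by zero, satisfies \<open>f (x + t) = exp (L t) * f x\<close> for
  \<open>t \<in> H\<close>. If it were \<open>a + b exp (g x)\<close>, then \<open>g\<close> would be constant on the complement of \<open>H\<close>,
  which is invariant under \<open>H\<close>, so \<open>g\<close> would vanish on \<open>H\<close>.
\<close>

section \<open>Signed distance to the nearest integer, and its growth along factorial
  multiples\<close>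

definition int_dev :: "real \<Rightarrow> real" where
  "int_dev u = u - of_int (round u)"

lemma int_dev_eqI:
  assumes "\<bar>u - of_int p\<bar> < 1 / 2"
  shows "int_dev u = u - of_int p"
  using round_unique'[OF assms] by (simp add: int_dev_def)

lemma int_dev_add:
  assumes "\<bar>int_dev u + int_dev v\<bar> < 1 / 2"
  shows "int_dev (u + v) = int_dev u + int_dev v"
  using int_dev_eqI[of "u + v" "round u + round v"] assms by (simp add: int_dev_def algebra_simps)

lemma int_dev_uminus:
  assumes "\<bar>int_dev u\<bar> < 1 / 2"
  shows "int_dev (- u) = - int_dev u"
  using int_dev_eqI[of "- u" "- round u"] assms by (simp add: int_dev_def abs_minus_commute)

lemma borel_measurable_int_dev [measurable]: "int_dev \<in> borel_measurable borel"
  unfolding int_dev_def round_def by measurable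

text \<open>The factor must tend to infinity, so that convergence forces the deviations into the
  range where \<open>int_dev\<close> is additive, and must be o(m), so that errors O(1/m) in
  prescribed deviations vanish in the limit. The square root does both.\<close>

definition scaled_dev :: "real \<Rightarrow> nat \<Rightarrow> real" where
  "scaled_dev x m = sqrt (real m) * int_dev (fact m * x)"

lemma int_dev_tendsto_0:
  assumes "scaled_dev x \<longlonglongrightarrow> l"
  shows "(\<lambda>m. int_dev (fact m * x)) \<longlonglongrightarrow> 0"
proof -
  have "(\<lambda>m. 1 / sqrt (real m)) \<longlonglongrightarrow> 0"
    by real_asymp
  from tendsto_mult[OF this assms]
  have "(\<lambda>m. 1 / sqrt (real m) * scaled_dev x m) \<longlonglongrightarrow> 0"
    by simp
  \<comment> \<open>The equality can fail at m = 0, where the scaling factor is 0.\<close>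
  moreover have "\<forall>\<^sub>F m in sequentially. 1 / sqrt (real m) * scaled_dev x m = int_dev (fact m * x)"
    using eventually_gt_at_top[of 0] by eventually_elim (simp add: scaled_dev_def)
  ultimately show ?thesis
    by (simp add: tendsto_cong)
qed

lemma scaled_dev_add:
  assumes "scaled_dev x \<longlonglongrightarrow> k" "scaled_dev y \<longlonglongrightarrow> l"
  shows "scaled_dev (x + y) \<longlonglongrightarrow> k + l"
proof -
  have "(\<lambda>m. \<bar>int_dev (fact m * x) + int_dev (fact m * y)\<bar>) \<longlonglongrightarrow> \<bar>0 + 0\<bar>"
    using assms[THEN int_dev_tendsto_0] by (intro tendsto_intros)
  then have "\<forall>\<^sub>F m in sequentially. \<bar>int_dev (fact m * x) + int_dev (fact m * y)\<bar> < 1 / 2"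
    by (rule order_tendstoD) simp
  then have "\<forall>\<^sub>F m in sequentially. scaled_dev x m + scaled_dev y m = scaled_dev (x + y) m"
    by eventually_elim (simp add: scaled_dev_def int_dev_add distrib_left)
  with tendsto_add[OF assms] show ?thesis
    by (simp add: tendsto_cong)
qed

lemma scaled_dev_uminus:
  assumes "scaled_dev x \<longlonglongrightarrow> l"
  shows "scaled_dev (- x) \<longlonglongrightarrow> - l"
proof -
  have "(\<lambda>m. \<bar>int_dev (fact m * x)\<bar>) \<longlonglongrightarrow> \<bar>0\<bar>"
    using assms[THEN int_dev_tendsto_0] by (intro tendsto_intros)
  then have "\<forall>\<^sub>F m in sequentially. \<bar>int_dev (fact m * x)\<bar> < 1 / 2"
    by (rule order_tendstoD) simp
  then have "\<forall>\<^sub>F m in sequentially. - scaled_dev x m = scaled_dev (- x) m"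
    by eventually_elim (simp add: scaled_dev_def int_dev_uminus)
  with tendsto_minus[OF assms] show ?thesis
    by (simp add: tendsto_cong)
qed

text \<open>Both directions count: the complement of the subgroup must be invariant too for the
  extension by zero to obey the translation law.\<close>

lemma convergent_scaled_dev_add_iff:
  assumes "scaled_dev t \<longlonglongrightarrow> l"
  shows "convergent (scaled_dev (x + t)) \<longleftrightarrow> convergent (scaled_dev x)"
proof
  assume "convergent (scaled_dev (x + t))"
  then obtain k where "scaled_dev (x + t) \<longlonglongrightarrow> k"
    by (auto simp: convergent_def)
  from scaled_dev_add[OF this scaled_dev_uminus[OF assms]] show "convergent (scaled_dev x)"
    by (auto simp: convergent_def)
next
  assume "convergent (scaled_dev x)"
  with scaled_dev_add[OF _ assms] show "convergent (scaled_dev (x + t))"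
    by (auto simp: convergent_def)
qed

section \<open>Prescribing deviations by factorial series\<close>

lemma fact_multiple_near:
  fixes s :: "nat \<Rightarrow> real"
  assumes "\<And>m. \<bar>s m\<bar> \<le> B"
  obtains x C where "\<forall>m. \<exists>p::int. \<bar>fact m * x - of_int p - s m\<bar> \<le> C / real (Suc m)"
proof -
  \<comment> \<open>The witness is the sum of all \<open>w k\<close>. Multiplied by m!, its terms
    with k < m are integers, the term k = m is \<open>b m\<close> / (m+1), which the floor puts
    within 1/(m+1) of \<open>s m\<close>, and the later terms add up to O(1/(m+1)).\<close>
  define b where "b m = \<lfloor>s m * real (Suc m)\<rfloor>" for m
  define w where "w k = of_int (b k) / (fact (Suc k) :: real)" for k
  have "B \<ge> 0"
    using assms[of 0] by linarith
  have b_le: "\<bar>of_int (b m)\<bar> \<le> (B + 1) * real (Suc m)" for m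
  proof -
    have "\<bar>s m * real (Suc m)\<bar> \<le> B * real (Suc m)"
      using assms[of m] by (simp add: abs_mult mult_right_mono)
    moreover have "\<bar>of_int (b m) - s m * real (Suc m)\<bar> \<le> 1"
      unfolding b_def by linarith
    ultimately show ?thesis
      by (simp add: algebra_simps)
  qed
  have w_le: "\<bar>w k\<bar> \<le> (B + 1) / fact k" for k
  proof -
    have "\<bar>w k\<bar> = \<bar>of_int (b k)\<bar> / fact (Suc k)"
      by (simp add: w_def)
    also have "\<dots> \<le> (B + 1) * real (Suc k) / fact (Suc k)"
      using b_le by (intro divide_right_mono) auto
    also have "\<dots> = (B + 1) / fact k"
      by (simp add: fact_Suc del: of_nat_Suc)
    finally show ?thesis .
  qed
  have sum_exp: "summable (\<lambda>k. c / fact k)" for c :: real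
    using summable_mult[OF summable_exp[of "1::real"], of c] by (simp add: field_simps)
  have w_summable: "summable w"
    using w_le by (intro summable_comparison_test'[OF sum_exp[of "B + 1"]]) auto
  \<comment> \<open>The summand 1 pays for the floor in term m, the series for the tail.\<close>
  define C where "C = 1 + (\<Sum>j. (B + 1) / fact j)"
  show ?thesis
  proof (rule that, rule allI)
    fix m
    define p where "p = (\<Sum>k<m. b k * (fact m div fact (Suc k)))"
    have p: "of_int p = fact m * (\<Sum>k<m. w k)"
    proof -
      \<comment> \<open>The integer division is exact, as (k+1)! divides m! for k < m.\<close>
      have "of_int (fact m div fact (Suc k)) = (fact m / fact (Suc k) :: real)" if "k < m" for k
        using real_of_int_div[OF fact_dvd[of "Suc k" m, where 'a = int]] that
        by simp
      then show ?thesis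
        unfolding p_def w_def sum_distrib_left of_int_sum by (intro sum.cong) auto
    qed
    define R where "R = (\<Sum>k. w (k + Suc m))"
    have "suminf w = R + (\<Sum>k<Suc m. w k)"
      unfolding R_def by (rule suminf_split_initial_segment[OF w_summable])
    then have eq: "fact m * suminf w - of_int p - s m = fact m * R + (fact m * w m - s m)"
      by (simp add: p algebra_simps)
    have "\<bar>fact m * w m - s m\<bar> = \<bar>of_int (b m) - s m * real (Suc m)\<bar> / real (Suc m)"
      by (simp add: w_def fact_Suc field_simps abs_divide del: of_nat_Suc)
    also have "\<dots> \<le> 1 / real (Suc m)"
      unfolding b_def by (intro divide_right_mono) linarith+
    finally have first: "\<bar>fact m * w m - s m\<bar> \<le> 1 / real (Suc m)" .
    have tail: "\<bar>fact m * w (k + Suc m)\<bar> \<le> (B + 1) / fact k / real (Suc m)" for k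
    proof -
      \<comment> \<open>Splitting off (m+1)! leaves m!/(m+1)! = 1/(m+1) as the gain and 1/k! for
        summability.\<close>
      have "(fact k * fact (Suc m) :: nat) \<le> fact (k + Suc m)"
        by (intro dvd_imp_le fact_fact_dvd_fact) simp
      then have fact_le: "(fact k * fact (Suc m) :: real) \<le> fact (k + Suc m)"
        by (metis of_nat_fact of_nat_le_iff of_nat_mult)
      have "\<bar>fact m * w (k + Suc m)\<bar> \<le> fact m * ((B + 1) / fact (k + Suc m))"
        using mult_left_mono[OF w_le, of "fact m" "k + Suc m"] by (simp add: abs_mult del: fact_Suc add_Suc_right)
      also have "\<dots> \<le> fact m * ((B + 1) / (fact k * fact (Suc m)))"
        using fact_le \<open>B \<ge> 0\<close> by (intro mult_left_mono divide_left_mono) auto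
      also have "\<dots> = (B + 1) / fact k / real (Suc m)"
        by (simp add: fact_Suc del: of_nat_Suc)
      finally show ?thesis .
    qed
    have "fact m * R = (\<Sum>k. fact m * w (k + Suc m))"
      unfolding R_def using w_summable by (intro suminf_mult[symmetric]) (simp add: summable_iff_shift del: add_Suc_right)
    also have "norm \<dots> \<le> (\<Sum>k. (B + 1) / fact k / real (Suc m))"
      using tail by (intro norm_suminf_le summable_divide sum_exp) (simp del: of_nat_Suc)
    also have "\<dots> = (\<Sum>k. (B + 1) / fact k) / real (Suc m)"
      by (intro suminf_divide sum_exp)
    finally have "\<bar>fact m * R\<bar> \<le> (\<Sum>k. (B + 1) / fact k) / real (Suc m)"
      by simp
    with first have "\<bar>fact m * suminf w - of_int p - s m\<bar> \<le> C / real (Suc m)"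
      unfolding eq C_def add_divide_distrib by linarith
    then show "\<exists>p::int. \<bar>fact m * suminf w - of_int p - s m\<bar> \<le> C / real (Suc m)"
      by blast
  qed
qed

text \<open>As |l| < 1/2, \<open>s m\<close> plus the error is eventually below 1/2 in absolute
  value, so the integer supplied by \<open>fact_multiple_near\<close> is the nearest one.\<close>

lemma prescribed_int_dev:
  fixes s :: "nat \<Rightarrow> real"
  assumes "s \<longlonglongrightarrow> l" "\<bar>l\<bar> < 1 / 2"
  obtains x C where "\<forall>\<^sub>F m in sequentially. \<bar>int_dev (fact m * x) - s m\<bar> \<le> C / real (Suc m)"
proof -
  from assms(1) have "Bseq s"
    by (intro convergent_imp_Bseq) (auto simp: convergent_def)
  then obtain B where "\<And>m. \<bar>s m\<bar> \<le> B"
    by (auto simp: Bseq_def)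
  then obtain x C where x: "\<forall>m. \<exists>p::int. \<bar>fact m * x - of_int p - s m\<bar> \<le> C / real (Suc m)"
    by (rule fact_multiple_near)
  have "(\<lambda>m. C / real (Suc m) + \<bar>s m\<bar>) \<longlonglongrightarrow> 0 + \<bar>l\<bar>"
    by (intro tendsto_add tendsto_rabs assms) real_asymp
  then have "\<forall>\<^sub>F m in sequentially. C / real (Suc m) + \<bar>s m\<bar> < 1 / 2"
    by (rule order_tendstoD) (use assms(2) in simp)
  then have "\<forall>\<^sub>F m in sequentially. \<bar>int_dev (fact m * x) - s m\<bar> \<le> C / real (Suc m)"
  proof eventually_elim
    case (elim m)
    obtain p :: int where p: "\<bar>fact m * x - of_int p - s m\<bar> \<le> C / real (Suc m)"
      using x by blast
    with elim have "int_dev (fact m * x) = fact m * x - of_int p"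
      by (intro int_dev_eqI) linarith
    with p show ?case
      by simp
  qed
  then show ?thesis
    by (rule that)
qed

text \<open>Prescribing the deviations l / sqrt m costs an error of at most sqrt m * C/(m+1) after
  scaling, which tends to 0.\<close>

lemma scaled_dev_surj: "\<exists>x. scaled_dev x \<longlonglongrightarrow> l"
proof -
  have "(\<lambda>m. l / sqrt (real m)) \<longlonglongrightarrow> 0"
    by real_asymp
  then obtain x C where
    x: "\<forall>\<^sub>F m in sequentially. \<bar>int_dev (fact m * x) - l / sqrt (real m)\<bar> \<le> C / real (Suc m)"
    by (rule prescribed_int_dev) auto
  have "(\<lambda>m. scaled_dev x m - l) \<longlonglongrightarrow> 0"
  proof (rule Lim_null_comparison)
    show "\<forall>\<^sub>F m in sequentially. norm (scaled_dev x m - l) \<le> sqrt (real m) * (C / real (Suc m))"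
      using x eventually_gt_at_top[of 0]
    proof eventually_elim
      case (elim m)
      have "scaled_dev x m - l = sqrt (real m) * (int_dev (fact m * x) - l / sqrt (real m))"
        using elim(2) by (simp add: scaled_dev_def right_diff_distrib)
      then show ?case
        using mult_left_mono[OF elim(1), of "sqrt (real m)"] by (simp add: abs_mult)
    qed
    show "(\<lambda>m. sqrt (real m) * (C / real (Suc m))) \<longlonglongrightarrow> 0"
      by real_asymp
  qed
  then show ?thesis
    by (auto simp: LIM_zero_iff)
qed

text \<open>Deviations tending to 1/4 instead of 0 rule out convergence after scaling.\<close>

lemma scaled_dev_not_convergent: "\<exists>x. \<not> convergent (scaled_dev x)"
proof -
  obtain x C where
    x: "\<forall>\<^sub>F m in sequentially. \<bar>int_dev (fact m * x) - 1 / 4\<bar> \<le> C / real (Suc m)"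
    by (rule prescribed_int_dev[of "\<lambda>_. 1 / 4" "1 / 4"]) auto
  have "(\<lambda>m. int_dev (fact m * x) - 1 / 4) \<longlonglongrightarrow> 0"
  proof (rule Lim_null_comparison)
    show "\<forall>\<^sub>F m in sequentially. norm (int_dev (fact m * x) - 1 / 4) \<le> C / real (Suc m)"
      using x by simp
    show "(\<lambda>m. C / real (Suc m)) \<longlonglongrightarrow> 0"
      by real_asymp
  qed
  then have "(\<lambda>m. int_dev (fact m * x)) \<longlonglongrightarrow> 1 / 4"
    by (simp add: LIM_zero_iff)
  then have "\<not> (\<lambda>m. int_dev (fact m * x)) \<longlonglongrightarrow> 0"
    using LIMSEQ_unique by fastforce
  then show ?thesis
    using int_dev_tendsto_0 by (auto simp: convergent_def)
qed

section \<open>The function, its measurability and its translation law\<close>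

definition rigid_fun :: "real \<Rightarrow> real" where
  "rigid_fun x = (if convergent (scaled_dev x) then exp (lim (scaled_dev x)) else 0)"

lemma rigid_fun_limit: "scaled_dev x \<longlonglongrightarrow> l \<Longrightarrow> rigid_fun x = exp l"
  by (auto simp: rigid_fun_def convergent_def limI)

lemma rigid_fun_nonneg: "rigid_fun x \<ge> 0"
  by (simp add: rigid_fun_def)

lemma borel_measurable_rigid_fun: "rigid_fun \<in> borel_measurable borel"
proof -
  have [measurable]: "(\<lambda>x. scaled_dev x m) \<in> borel_measurable borel" for m
    unfolding scaled_dev_def by measurable
  \<comment> \<open>By completeness, convergence is the Cauchy property, a countable
    condition.\<close>
  have [measurable]: "Measurable.pred borel (\<lambda>x. convergent (scaled_dev x))"
    unfolding Cauchy_convergent_iff[symmetric] by (simp add: pred_def sets_Collect_Cauchy[of _ borel, simplified])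
  have [measurable]: "(\<lambda>x. lim (scaled_dev x)) \<in> borel_measurable borel"
    using borel_measurable_lim_metric[of "\<lambda>m x. scaled_dev x m" borel] by simp
  show ?thesis
    unfolding rigid_fun_def by measurable
qed

lemma rigid_fun_add:
  assumes "scaled_dev t \<longlonglongrightarrow> l"
  shows "rigid_fun (x + t) = exp l * rigid_fun x"
proof (cases "convergent (scaled_dev x)")
  case True
  then obtain k where k: "scaled_dev x \<longlonglongrightarrow> k"
    by (auto simp: convergent_def)
  from rigid_fun_limit[OF this] rigid_fun_limit[OF scaled_dev_add[OF this assms]] show ?thesis
    by (simp add: exp_add)
next
  case False
  then show ?thesis
    using convergent_scaled_dev_add_iff[OF assms] by (simp add: rigid_fun_def)
qed

section \<open>Rigidity and exclusion of the two forms\<close>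

lemma vertically_rigid_horizontalI:
  assumes "\<And>c. c > 0 \<Longrightarrow> \<exists>t. \<forall>x. f (x + t) = c * f x"
  shows "vertically_rigid_horizontal f"
  unfolding vertically_rigid_horizontal_def
proof (intro allI impI)
  fix c :: real
  assume "c > 0"
  with assms obtain t where t: "\<And>x. f (x + t) = c * f x"
    by blast
  have "(\<lambda>(x, y). (x + t, y)) ` graph_of (\<lambda>x. c * f x) = graph_of f"
  proof (intro equalityI subsetI)
    fix z assume "z \<in> graph_of f"
    then obtain x where "z = (x, f x)"
      by (auto simp: graph_of_def)
    moreover from t[of "x - t"] have "f x = c * f (x - t)"
      by simp
    ultimately have "z = (\<lambda>(x, y). (x + t, y)) (x - t, c * f (x - t))"
      by simp
    then show "z \<in> (\<lambda>(x, y). (x + t, y)) ` graph_of (\<lambda>x. c * f x)"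
      unfolding graph_of_def by blast
  qed (auto simp: graph_of_def t)
  then show "\<exists>\<phi>. horizontal_translation \<phi> \<and> \<phi> ` graph_of (\<lambda>x. c * f x) = graph_of f"
    unfolding horizontal_translation_def by blast
qed

lemma rigid_fun_values: "v > 0 \<Longrightarrow> \<exists>x. rigid_fun x = v"
  using scaled_dev_surj[of "ln v"] rigid_fun_limit by fastforce

lemma rigid_fun_not_affine: "rigid_fun \<noteq> (\<lambda>x. a + b * x)"
proof
  assume eq: "rigid_fun = (\<lambda>x. a + b * x)"
  show False
  proof (cases "b = 0")
    case True
    with eq rigid_fun_values[of 1] rigid_fun_values[of 2] show False
      by (simp add: fun_eq_iff)
  next
    case False
    \<comment> \<open>A non-constant affine function takes the value -1, against
      nonnegativity.\<close>
    then have "rigid_fun ((- 1 - a) / b) = - 1"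
      by (subst eq) simp
    with rigid_fun_nonneg[of "(- 1 - a) / b"] show False
      by simp
  qed
qed

lemma rigid_fun_not_exp_additive:
  assumes "Modules.additive g"
  shows "rigid_fun \<noteq> (\<lambda>x. a + b * exp (g x))"
proof
  assume eq: "rigid_fun = (\<lambda>x. a + b * exp (g x))"
  have b: "b \<noteq> 0"
    using eq rigid_fun_not_affine[of a 0] by auto
  obtain x where x: "\<not> convergent (scaled_dev x)"
    using scaled_dev_not_convergent by blast
  have zero: "g t = 0" if "scaled_dev t \<longlonglongrightarrow> l" for t l
  proof -
    \<comment> \<open>Both values are 0, since \<open>x\<close> lies outside the subgroup.\<close>
    have "rigid_fun (x + t) = rigid_fun x"
      using x rigid_fun_add[OF that] by (simp add: rigid_fun_def)
    then have "a + b * exp (g (x + t)) = a + b * exp (g x)"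
      by (simp only: eq)
    with b have "g (x + t) = g x"
      by simp
    then show "g t = 0"
      by (simp add: additive.add[OF assms])
  qed
  \<comment> \<open>Two points of the subgroup with different limits: \<open>g\<close> vanishes at
    both, yet the values are 1 and e.\<close>
  obtain t0 t1 where "scaled_dev t0 \<longlonglongrightarrow> 0" "scaled_dev t1 \<longlonglongrightarrow> 1"
    using scaled_dev_surj by blast
  then have "rigid_fun t0 = exp 0" "rigid_fun t1 = exp 1" "g t0 = g t1"
    using rigid_fun_limit zero by metis+
  moreover from this(3) have "rigid_fun t0 = rigid_fun t1"
    by (simp only: eq)
  ultimately show False
    by simp
qed

theorem theorem3p1:
  shows "\<exists>f :: real \<Rightarrow> real.
    f \<in> borel_measurable borel \<and>
    (\<forall>x. f x \<in> {0..}) \<and>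
    vertically_rigid_horizontal f \<and>
    \<not> (\<exists>a b :: real. f = (\<lambda>x. a + b * x)) \<and>
    \<not> (\<exists>(a :: real) (b :: real) (g :: real \<Rightarrow> real). Modules.additive g \<and> f = (\<lambda>x. a + b * exp (g x)))"
proof (intro exI conjI)
  show "rigid_fun \<in> borel_measurable borel"
    by (rule borel_measurable_rigid_fun)
  show "\<forall>x. rigid_fun x \<in> {0..}"
    by (simp add: rigid_fun_nonneg)
  show "vertically_rigid_horizontal rigid_fun"
  proof (rule vertically_rigid_horizontalI)
    fix c :: real
    assume "c > 0"
    \<comment> \<open>A shift with limit ln c multiplies the function by c.\<close>
    with scaled_dev_surj[of "ln c"] show "\<exists>t. \<forall>x. rigid_fun (x + t) = c * rigid_fun x"
      using rigid_fun_add by fastforce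
  qed
  show "\<not> (\<exists>a b. rigid_fun = (\<lambda>x. a + b * x))"
    using rigid_fun_not_affine by blast
  show "\<not> (\<exists>a b g. Modules.additive g \<and> rigid_fun = (\<lambda>x. a + b * exp (g x)))"
    using rigid_fun_not_exp_additive by blast
qed

end
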